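(* Let $\alpha\le1$ and let $f\in\mathfrak{A}^1_\alpha$ have the Taylor expansion $f(z)=z+\sum_{k=2}^\infty a_kz^k$. The following assertions hold: (i) $|a_{k+1}|\le\frac{2-\alpha}{k(1-\alpha)+1}$ for all $k\in\mathbb{N}$. Moreover, $|a_3|\le\frac{2-\alpha}{3-2\alpha}(1-|a_2|^2)$ and $|a_4|\le\frac{2-\alpha}{4-3\alpha}(1-|a_2|^2)$. (ii) For every $\lambda\in\mathbb{C}$ we have $|\Phi(f,\lambda)|\le\max\left(\frac{2-\alpha}{3-2\alpha},\,|\lambda|\right)$.
   Context: Let $\mathbb{D}$ be the open unit disk and $\mathbb{N}=\{1,2,\dots\}$. $\mathcal{A}$ is the set of holomorphic $f:\mathbb{D}\to\mathbb{C}$ with $f(0)=0$, $f'(0)=1$; $f(z)/z$ is extended by its limit at $0$. For $\alpha\le1$, $$\mathfrak{A}^1_\alpha=\left\{f\in\mathcal{A}:\ \left|\alpha\frac{f(z)}{z}+(1-\alpha)f'(z)-1\right|\le2-\alpha,\ z\in\mathbb{D}\right\}.$$ For $f(z)=z+\sum_{n\ge2}a_nz^n$ and $\lambda\in\mathbb{C}$, the Fekete–Szegő functional is $\Phi(f,\lambda)=a_3-\lambda a_2^2$. *)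

theory Defs
  imports "HOL-Complex_Analysis.Complex_Analysis"
begin

text \<open>
  Functions on the unit disk are total functions \<^typ>\<open>complex \<Rightarrow> complex\<close>; only their values on
  \<^term>\<open>ball (0::complex) 1\<close> matter.
\<close>

definition class_A :: "(complex \<Rightarrow> complex) set" where
  "class_A = {f. f holomorphic_on ball 0 1 \<and> f 0 = 0 \<and> deriv f 0 = 1}"

definition quot_z :: "(complex \<Rightarrow> complex) \<Rightarrow> complex \<Rightarrow> complex" where
  "quot_z f z = (if z = 0 then Lim (at 0) (\<lambda>w. f w / w) else f z / z)"

definition frak_A1 :: "real \<Rightarrow> (complex \<Rightarrow> complex) set" where
  "frak_A1 \<alpha> = {f \<in> class_A. \<forall>z\<in>ball 0 1.
     norm (of_real \<alpha> * quot_z f z + (1 - of_real \<alpha>) * deriv f z - 1) \<le> 2 - \<alpha>}"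

text \<open>The coefficients \<open>a\<^sub>2\<close>, \<open>a\<^sub>3\<close> are those of the Taylor series of \<open>f\<close> at the origin.\<close>

definition fekete_szego :: "(complex \<Rightarrow> complex) \<Rightarrow> complex \<Rightarrow> complex" where
  "fekete_szego f \<mu> =
     fps_nth (fps_expansion f 0) 3 - \<mu> * (fps_nth (fps_expansion f 0) 2)\<^sup>2"

end

theory Submission
  imports Defs
begin

text \<open>
  Comparing Taylor coefficients, \<open>\<alpha> f(z)/z + (1 - \<alpha>) f'(z) - 1 = (2 - \<alpha>) z p(z)\<close> where
  \<open>p(z) = c\<^sub>0 + c\<^sub>1 z + \<dots>\<close> has \<open>c\<^sub>n = ((n + 1)(1 - \<alpha>) + 1) a\<^sub>n\<^sub>+\<^sub>2 / (2 - \<alpha>)\<close>, so that \<open>c\<^sub>0 = a\<^sub>2\<close>,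
  and \<open>\<bar>p\<bar> \<le> 1\<close> by Schwarz's lemma. Everything then follows from Wiener's inequality
  \<open>\<bar>c\<^sub>n\<bar> \<le> 1 - \<bar>c\<^sub>0\<bar>\<^sup>2\<close>: averaging \<open>p\<close> over the rotations by \<open>n\<close>-th roots of unity keeps only the
  coefficients with index divisible by \<open>n\<close>, and composing this average with the disc automorphism
  that sends \<open>c\<^sub>0\<close> to \<open>0\<close> gives a function with a zero of order \<open>n\<close> to which Schwarz's lemma applies.
\<close>

text \<open>This is the division step of Schwarz's lemma for a zero of order \<open>n\<close>: on
  the circle of radius \<open>s\<close> the hypothesis bounds \<open>h\<close> by
  \<open>1 / s ^ n\<close>, the maximum modulus principle carries the bound inside, and
  \<open>s\<close> tends to 1.\<close>

lemma norm_le_one_of_power_mult: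
  fixes h :: "complex \<Rightarrow> complex"
  assumes h: "h holomorphic_on ball 0 1"
    and le: "\<And>z. z \<in> ball 0 1 \<Longrightarrow> z \<noteq> 0 \<Longrightarrow> norm (z ^ n * h z) \<le> 1"
    and z: "z \<in> ball 0 1"
  shows "norm (h z) \<le> 1"
proof -
  have bound: "s ^ n * norm (h z) \<le> 1" if s: "norm z < s" "s < 1" for s
  proof -
    from s have s0: "s > 0" using norm_ge_zero[of z] by linarith
    have "norm (h z) \<le> 1 / s ^ n"
    proof (rule maximum_modulus_frontier[of h "cball 0 s"])
      show "h holomorphic_on interior (cball 0 s)"
        using s by (intro holomorphic_on_subset[OF h]) auto
      show "continuous_on (closure (cball 0 s)) h"
        using s by (intro holomorphic_on_imp_continuous_on holomorphic_on_subset[OF h]) auto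
      show "norm (h w) \<le> 1 / s ^ n" if "w \<in> frontier (cball 0 s)" for w
      proof -
        have "norm w = s" using that s0 by auto
        then show ?thesis
          using le[of w] s s0 by (auto simp: norm_mult norm_power field_simps)
      qed
    qed (use s in auto)
    then show ?thesis using s0 by (simp add: field_simps)
  qed
  have "((\<lambda>s. s ^ n * norm (h z)) \<longlongrightarrow> 1 ^ n * norm (h z)) (at_left 1)"
    by (intro tendsto_intros)
  moreover have "eventually (\<lambda>s. s ^ n * norm (h z) \<le> 1) (at_left (1::real))"
    using bound z by (auto simp: eventually_at_left_field intro!: exI[of _ "norm z"])
  ultimately show ?thesis
    using tendsto_upperbound[of "\<lambda>s. s ^ n * norm (h z)"] by fastforce
qed

text \<open>When \<open>norm c < 1\<close>, the disc automorphism vanishing at \<open>c\<close>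
  turns \<open>p\<close> into \<open>z ^ n * r z / (1 - cnj c * p z)\<close>. Dividing out
  \<open>z ^ n\<close> leaves a function bounded by 1 whose value at 0 is
  \<open>r 0 / (1 - (norm c)\<^sup>2)\<close>.\<close>

lemma norm_lacunary_coeff_le:
  fixes p r :: "complex \<Rightarrow> complex"
  assumes p: "p holomorphic_on ball 0 1" and r: "r holomorphic_on ball 0 1"
    and le: "\<And>z. z \<in> ball 0 1 \<Longrightarrow> norm (p z) \<le> 1"
    and eq: "\<And>z. z \<in> ball 0 1 \<Longrightarrow> p z = c + z ^ n * r z" and n: "n \<ge> 1"
  shows "norm (r 0) \<le> 1 - (norm c)\<^sup>2"
proof -
  have p0: "p 0 = c" using eq[of 0] n by simp
  have c1: "norm c \<le> 1" using le[of 0] p0 by simp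
  \<comment> \<open>Scaling by \<open>t < 1\<close> avoids the degenerate case \<open>\<bar>c\<bar> = 1\<close>, where the disc automorphism breaks down.\<close>
  have bound: "t * norm (r 0) \<le> 1 - t\<^sup>2 * (norm c)\<^sup>2" if t: "0 < t" "t < 1" for t :: real
  proof -
    have lt: "norm (of_real t * u) < 1" if "norm u \<le> 1" for u :: complex
    proof -
      have "t * norm u \<le> t * 1" using t that by (intro mult_left_mono) auto
      then have "t * norm u < 1" using t by linarith
      then show ?thesis using t by (simp add: norm_mult)
    qed
    define d where "d z = 1 - cnj (of_real t * c) * (of_real t * p z)" for z
    have d0: "d z \<noteq> 0" if "z \<in> ball 0 1" for z
    proof
      assume "d z = 0"
      then have "norm (cnj (of_real t * c) * (of_real t * p z)) = 1" by (simp add: d_def)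
      moreover have "norm (cnj (of_real t * c) * (of_real t * p z)) < 1 * 1"
        unfolding norm_mult[of "cnj (of_real t * c)"] complex_mod_cnj
        by (intro mult_strict_mono' lt le that c1) auto
      ultimately show False by simp
    qed
    \<comment> \<open>The automorphism vanishing at \<open>of_real t * c\<close>, applied to
      \<open>of_real t * p z\<close>, has numerator
      \<open>of_real t * (p z - c) = of_real t * z ^ n * r z\<close>; \<open>h\<close> is what
      remains after dividing by \<open>z ^ n\<close>.\<close>
    define h where "h z = of_real t * r z / d z" for z
    have "norm (h 0) \<le> 1"
    proof (rule norm_le_one_of_power_mult[where h = h and n = n])
      show "h holomorphic_on ball 0 1"
        unfolding h_def d_def using d0 unfolding d_def by (intro holomorphic_intros p r) auto
      show "norm (z ^ n * h z) \<le> 1" if z: "z \<in> ball 0 1" for z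
      proof -
        have "z ^ n * h z = Moebius_function 0 (of_real t * c) (of_real t * p z)"
          unfolding Moebius_function_simple h_def d_def
          using eq[OF z] by (simp add: algebra_simps)
        moreover have "norm \<dots> < 1"
          by (intro Moebius_function_norm_lt_1 lt c1 le z)
        ultimately show ?thesis by simp
      qed
    qed auto
    moreover have "d 0 = of_real (1 - t\<^sup>2 * (norm c)\<^sup>2)"
      using complex_norm_square[of c] by (simp add: d_def p0 power2_eq_square)
    moreover have "t\<^sup>2 * (norm c)\<^sup>2 < 1"
      using lt[OF c1] t by (simp add: norm_mult power_mult_distrib[symmetric] power_less_one_iff)
    ultimately show ?thesis
      using t by (simp add: h_def norm_divide norm_mult field_simps del: of_real_diff)
  qed
  have "((\<lambda>t. t * norm (r 0)) \<longlongrightarrow> 1 * norm (r 0)) (at_left 1)"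
    "((\<lambda>t. 1 - t\<^sup>2 * (norm c)\<^sup>2) \<longlongrightarrow> 1 - 1\<^sup>2 * (norm c)\<^sup>2) (at_left 1)"
    by (intro tendsto_intros)+
  moreover have "eventually (\<lambda>t. t * norm (r 0) \<le> 1 - t\<^sup>2 * (norm c)\<^sup>2) (at_left (1::real))"
    using bound by (auto simp: eventually_at_left_field intro!: exI[of _ 0])
  ultimately show ?thesis
    using tendsto_le[of "at_left (1::real)"] by fastforce
qed

text \<open>The sum is geometric and its ratio is an \<open>n\<close>-th root of unity: all terms
  are 1 if the ratio is 1, which happens exactly when \<open>n dvd m\<close>, and otherwise the
  closed form vanishes.\<close>

lemma sum_powers_root_of_unity:
  assumes "n \<ge> 1"
  shows "(\<Sum>j<n. (exp (2 * of_real pi * \<i> / of_nat n) ^ j) ^ m) = (if n dvd m then of_nat n else (0::complex))"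
proof -
  define w where "w = exp (2 * of_real pi * \<i> / of_nat n :: complex)"
  have wm: "w ^ m = 1 \<longleftrightarrow> n dvd m"
    using complex_root_unity_eq_1[OF assms, of m]
    by (simp add: w_def exp_of_nat_mult[symmetric] mult_ac)
  have "w ^ n = 1"
    using assms by (simp add: w_def exp_of_nat_mult[symmetric])
  then have "(w ^ m) ^ n = 1"
    by (metis mult.commute power_mult power_one)
  then show ?thesis
    unfolding w_def[symmetric] using wm sum_gp_strict[of "w ^ m" n]
    by (simp add: power_mult[symmetric] mult.commute)
qed

text \<open>The rotation average \<open>q\<close> inherits the bound 1 from \<open>p\<close> and has
  the form \<open>c 0 + z ^ n * r z\<close> with \<open>r 0 = c n\<close>, so Wiener's inequality
  reduces to \<open>norm_lacunary_coeff_le\<close>.\<close>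

lemma power_series_coeff_le:
  fixes p :: "complex \<Rightarrow> complex" and c :: "nat \<Rightarrow> complex"
  assumes sums: "\<And>z. z \<in> ball 0 1 \<Longrightarrow> (\<lambda>m. c m * z ^ m) sums p z"
    and le: "\<And>z. z \<in> ball 0 1 \<Longrightarrow> norm (p z) \<le> 1" and n: "n \<ge> 1"
  shows "norm (c n) \<le> 1 - (norm (c 0))\<^sup>2"
proof -
  define w where "w = exp (2 * of_real pi * \<i> / of_nat n :: complex)"
  have w1: "norm (w ^ j) = 1" for j
    unfolding w_def norm_power by simp
  define q where "q z = (\<Sum>j<n. p (w ^ j * z)) / of_nat n" for z
  define e where "e m = (if n dvd m then c m else 0)" for m
  define r where "r z = (\<Sum>m. e (m + n) * z ^ m)" for z
  have wz: "w ^ j * z \<in> ball 0 1" if "z \<in> ball 0 1" for j z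
    using that w1[of j] by (simp add: norm_mult)
  have q_sums: "(\<lambda>m. e m * z ^ m) sums q z" if z: "z \<in> ball 0 1" for z
  proof -
    have "(\<lambda>m. (\<Sum>j<n. c m * (w ^ j * z) ^ m) / of_nat n) sums q z"
      unfolding q_def by (intro sums_divide sums_sum sums wz z)
    also have "(\<lambda>m. (\<Sum>j<n. c m * (w ^ j * z) ^ m) / of_nat n) = (\<lambda>m. e m * z ^ m)"
    proof
      fix m
      have "(\<Sum>j<n. c m * (w ^ j * z) ^ m) = c m * z ^ m * (\<Sum>j<n. (w ^ j) ^ m)"
        by (simp add: sum_distrib_left power_mult_distrib mult_ac)
      then show "(\<Sum>j<n. c m * (w ^ j * z) ^ m) / of_nat n = e m * z ^ m"
        using n unfolding w_def sum_powers_root_of_unity[OF n] e_def by simp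
    qed
    finally show ?thesis .
  qed
  have r_sums: "(\<lambda>m. e (m + n) * z ^ m) sums r z" if z: "z \<in> ball 0 1" for z
  proof (cases "z = 0")
    case True
    then show ?thesis
      unfolding r_def by (intro summable_sums) simp
  next
    case False
    have "summable (\<lambda>m. e (m + n) * z ^ (m + n))"
      using q_sums[OF z] summable_iff_shift[of "\<lambda>m. e m * z ^ m" n] by (auto simp: sums_iff)
    then have "summable (\<lambda>m. e (m + n) * z ^ (m + n) / z ^ n)" by (rule summable_divide)
    then show ?thesis
      using False unfolding r_def by (intro summable_sums) (simp add: power_add)
  qed
  have "norm (r 0) \<le> 1 - (norm (c 0))\<^sup>2"
  proof (rule norm_lacunary_coeff_le[where p = q and n = n])
    show "q holomorphic_on ball 0 1"
      using q_sums by (intro power_series_holomorphic[where a = e]) auto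
    show "r holomorphic_on ball 0 1"
      using r_sums by (intro power_series_holomorphic[where a = "\<lambda>m. e (m + n)"]) auto
    show "norm (q z) \<le> 1" if z: "z \<in> ball 0 1" for z
    proof -
      have "norm (\<Sum>j<n. p (w ^ j * z)) \<le> of_nat (card {..<n}) * 1"
        by (intro sum_norm_bound le wz z)
      then show ?thesis using n by (simp add: q_def norm_divide field_simps)
    qed
    show "q z = c 0 + z ^ n * r z" if z: "z \<in> ball 0 1" for z
    proof -
      have "(\<lambda>m. e (m + n) * z ^ m * z ^ n) sums (r z * z ^ n)"
        by (intro sums_mult2 r_sums z)
      then have "(\<lambda>m. e (m + n) * z ^ (m + n)) sums (r z * z ^ n)"
        by (simp add: power_add mult_ac)
      then have "(\<lambda>m. e m * z ^ m) sums (r z * z ^ n + (\<Sum>m<n. e m * z ^ m))"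
        by (rule sums_iff_shift[THEN iffD1])
      \<comment> \<open>\<open>e\<close> vanishes strictly between 0 and \<open>n\<close>, so only
        the constant term survives.\<close>
      moreover have "(\<Sum>m<n. e m * z ^ m) = (\<Sum>m\<in>{0}. e m * z ^ m)"
        by (rule sum.mono_neutral_right) (use n in \<open>auto simp: e_def dest: dvd_imp_le\<close>)
      ultimately show ?thesis
        using sums_unique2[OF q_sums[OF z]] by (simp add: e_def mult.commute)
    qed
  qed (fact n)
  moreover have "r 0 = c n"
    using r_sums[of 0] sums_unique2[OF powser_sums_zero[of "\<lambda>m. e (m + n)"]] by (simp add: e_def)
  ultimately show ?thesis by simp
qed

theorem theorem6p4:
  fixes \<alpha> :: real and f :: "complex \<Rightarrow> complex" and a :: "nat \<Rightarrow> complex"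
  assumes "\<alpha> \<le> 1"
    and "f \<in> frak_A1 \<alpha>"
    and "\<And>z. z \<in> ball 0 1 \<Longrightarrow> (\<lambda>n. a (n + 2) * z ^ (n + 2)) sums (f z - z)"
  shows "(\<forall>k::nat. k \<ge> 1 \<longrightarrow> norm (a (k + 1)) \<le> (2 - \<alpha>) / (real k * (1 - \<alpha>) + 1))
       \<and> norm (a 3) \<le> (2 - \<alpha>) / (3 - 2 * \<alpha>) * (1 - (norm (a 2))\<^sup>2)
       \<and> norm (a 4) \<le> (2 - \<alpha>) / (4 - 3 * \<alpha>) * (1 - (norm (a 2))\<^sup>2)
       \<and> (\<forall>\<mu>::complex. norm (fekete_szego f \<mu>) \<le> max ((2 - \<alpha>) / (3 - 2 * \<alpha>)) (norm \<mu>))"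
proof -
  \<comment> \<open>The hypothesis fixes \<open>a\<close> only from index 2 on; \<open>A\<close>
    supplies the coefficients 0 and 1 of \<open>f\<close> below that.\<close>
  define A where "A n = (if n < 2 then of_nat n else a n)" for n
  have A_sums: "(\<lambda>n. A n * z ^ n) sums f z" if z: "z \<in> ball 0 1" for z
    using assms(3)[OF z] sums_iff_shift[of "\<lambda>n. A n * z ^ n" 2 "f z - z"]
    by (simp add: A_def numeral_2_eq_2)
  have f: "f holomorphic_on ball 0 1" using assms(2) by (simp add: frak_A1_def class_A_def)
  have f'_sums: "(\<lambda>n. of_nat (n + 2) * a (n + 2) * z ^ (n + 1)) sums (deriv f z - 1)"
    if z: "z \<in> ball 0 1" for z
  proof -
    have "(\<lambda>n. diffs A n * z ^ n) sums deriv f z"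
      using z A_sums holomorphic_derivI[OF f open_ball z]
      by (intro termdiffs_sums_strong[where K = 1 and f = f]) auto
    then have "(\<lambda>n. diffs A (n + 1) * z ^ (n + 1)) sums (deriv f z - (\<Sum>n<1. diffs A n * z ^ n))"
      by (rule sums_split_initial_segment)
    then show ?thesis by (simp add: diffs_def A_def)
  qed
  \<comment> \<open>This is \<open>\<alpha> + (1 - \<alpha>) * (n + 2)\<close>, the factor that the
    operator puts on \<open>a (n + 2)\<close>, and also the denominator in (i) for
    \<open>k = n + 1\<close>.\<close>
  define \<nu> where "\<nu> n = real (n + 1) * (1 - \<alpha>) + 1" for n
  have \<nu>: "\<nu> n \<ge> 1" for n using assms(1) by (simp add: \<nu>_def)
  define c where "c n = of_real (\<nu> n) * a (n + 2) / of_real (2 - \<alpha>)" for n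
  define p where "p z = (\<Sum>n. c n * z ^ n)" for z
  \<comment> \<open>The constant terms \<alpha> and \<open>1 - \<alpha>\<close> of the two series
    cancel against the \<open>- 1\<close>.\<close>
  have zp_sums: "(\<lambda>n. c n * z ^ (n + 1)) sums
      ((of_real \<alpha> * quot_z f z + (1 - of_real \<alpha>) * deriv f z - 1) / of_real (2 - \<alpha>))"
    if z: "z \<in> ball 0 1" "z \<noteq> 0" for z
  proof -
    have "(\<lambda>n. (of_real \<alpha> * (a (n + 2) * z ^ (n + 2) / z)
        + (1 - of_real \<alpha>) * (of_nat (n + 2) * a (n + 2) * z ^ (n + 1))) / of_real (2 - \<alpha>))
      sums ((of_real \<alpha> * ((f z - z) / z) + (1 - of_real \<alpha>) * (deriv f z - 1)) / of_real (2 - \<alpha>))"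
      by (intro sums_divide sums_add sums_mult assms(3) f'_sums z)
    also have "(\<lambda>n. (of_real \<alpha> * (a (n + 2) * z ^ (n + 2) / z)
        + (1 - of_real \<alpha>) * (of_nat (n + 2) * a (n + 2) * z ^ (n + 1))) / of_real (2 - \<alpha>))
      = (\<lambda>n. c n * z ^ (n + 1))"
      using z(2) by (simp add: c_def \<nu>_def fun_eq_iff add_divide_distrib[symmetric] algebra_simps)
    also have "of_real \<alpha> * ((f z - z) / z) + (1 - of_real \<alpha>) * (deriv f z - 1)
      = of_real \<alpha> * quot_z f z + (1 - of_real \<alpha>) * deriv f z - 1"
      using z(2) by (simp add: quot_z_def diff_divide_distrib algebra_simps)
    finally show ?thesis .
  qed
  have p_sums: "(\<lambda>n. c n * z ^ n) sums p z" if z: "z \<in> ball 0 1" for z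
  proof (cases "z = 0")
    case True
    then show ?thesis
      unfolding p_def by (intro summable_sums) simp
  next
    case False
    have "summable (\<lambda>n. c n * z ^ (n + 1) / z)"
      using zp_sums[OF z False] by (intro summable_divide) (rule sums_summable)
    then show ?thesis
      using False unfolding p_def by (intro summable_sums) simp
  qed
  \<comment> \<open>Schwarz's lemma with exponent 1: off the origin, \<open>z * p z\<close> is the
    expression defining the class divided by \<open>2 - \<alpha>\<close>.\<close>
  have p_le: "norm (p z) \<le> 1" if "z \<in> ball 0 1" for z
  proof (rule norm_le_one_of_power_mult[OF _ _ that, of p 1])
    show "p holomorphic_on ball 0 1"
      using p_sums by (intro power_series_holomorphic[where a = c]) auto
    fix z :: complex assume z: "z \<in> ball 0 1" "z \<noteq> 0"
    have "(\<lambda>n. c n * z ^ n * z) sums (p z * z)"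
      by (intro sums_mult2 p_sums z)
    then have "z ^ 1 * p z
        = (of_real \<alpha> * quot_z f z + (1 - of_real \<alpha>) * deriv f z - 1) / of_real (2 - \<alpha>)"
      using sums_unique2[OF zp_sums[OF z]] by (simp add: mult_ac)
    also have "norm \<dots> \<le> 1"
      using assms(1,2) z unfolding norm_divide norm_of_real
      by (auto simp: frak_A1_def divide_le_eq_1)
    finally show "norm (z ^ 1 * p z) \<le> 1" .
  qed
  have c_le: "norm (c n) \<le> 1 - (norm (c 0))\<^sup>2" if "n \<ge> 1" for n
    using power_series_coeff_le[OF p_sums p_le that] .
  have a_c: "norm (a (n + 2)) = (2 - \<alpha>) / \<nu> n * norm (c n)" for n
    using assms(1) \<nu>[of n] by (simp add: c_def norm_mult norm_divide flip: of_real_diff)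
  \<comment> \<open>The factors cancel because \<open>\<nu> 0 = 2 - \<alpha>\<close>.\<close>
  have c0: "c 0 = a 2"
    using assms(1) by (simp add: c_def \<nu>_def complex_eq_iff numeral_2_eq_2)
  have "norm (c 0) \<le> 1"
    using p_le[of 0] sums_unique2[OF p_sums[of 0] powser_sums_zero[of c]] by simp
  then have c_le1: "norm (c n) \<le> 1" for n
    using c_le[of n] by (cases "n = 0") (auto intro: order_trans)
  have factor: "(2 - \<alpha>) / \<nu> n \<ge> 0" for n
    using assms(1) \<nu>[of n] by simp
  have \<nu>12: "\<nu> 1 = 3 - 2 * \<alpha>" "\<nu> 2 = 4 - 3 * \<alpha>" by (simp_all add: \<nu>_def)
  have a3: "norm (a 3) \<le> (2 - \<alpha>) / (3 - 2 * \<alpha>) * (1 - (norm (a 2))\<^sup>2)"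
    using mult_left_mono[OF c_le[of 1] factor[of 1]] a_c[of 1] unfolding \<nu>12 c0
    by (simp add: numeral_3_eq_3)
  have a4: "norm (a 4) \<le> (2 - \<alpha>) / (4 - 3 * \<alpha>) * (1 - (norm (a 2))\<^sup>2)"
    using mult_left_mono[OF c_le[of 2] factor[of 2]] a_c[of 2] unfolding \<nu>12 c0 by simp
  have "norm (a (k + 1)) \<le> (2 - \<alpha>) / (real k * (1 - \<alpha>) + 1)" if "k \<ge> 1" for k
    using mult_left_mono[OF c_le1[of "k - 1"] factor[of "k - 1"]] a_c[of "k - 1"] that
    by (simp add: \<nu>_def Suc_diff_Suc)
  moreover have "norm (fekete_szego f \<mu>) \<le> max ((2 - \<alpha>) / (3 - 2 * \<alpha>)) (norm \<mu>)" for \<mu>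
  proof -
    have "f has_fps_expansion Abs_fps A"
      by (intro has_fps_expansionI eventually_nhds_in_open[THEN eventually_mono, of "ball 0 1"])
        (use A_sums in auto)
    then have "fps_expansion f 0 = Abs_fps A" by (rule fps_expansion_eqI)
    then have "fekete_szego f \<mu> = a 3 - \<mu> * (a 2)\<^sup>2"
      by (simp add: fekete_szego_def A_def)
    then have "norm (fekete_szego f \<mu>) \<le> norm (a 3) + norm \<mu> * (norm (a 2))\<^sup>2"
      using norm_triangle_ineq4[of "a 3" "\<mu> * (a 2)\<^sup>2"] by (simp add: norm_mult norm_power)
    also have "\<dots> \<le> (2 - \<alpha>) / (3 - 2 * \<alpha>) * (1 - (norm (a 2))\<^sup>2) + norm \<mu> * (norm (a 2))\<^sup>2"
      using a3 by simp
    \<comment> \<open>The left side is a convex combination of the two entries of the maximum, with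
      weights \<open>1 - (norm (a 2))\<^sup>2\<close> and \<open>(norm (a 2))\<^sup>2\<close>; these
      are nonnegative since \<open>norm (a 2) \<le> 1\<close>.\<close>
    also have "\<dots> \<le> max ((2 - \<alpha>) / (3 - 2 * \<alpha>)) (norm \<mu>)"
      using c_le1[of 0] unfolding c0 mult.commute[of _ "1 - _"] mult.commute[of "norm \<mu>"]
      by (intro convex_bound_le) (auto simp: power_le_one)
    finally show ?thesis .
  qed
  ultimately show ?thesis using a3 a4 by blast
qed

end
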